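(* There exist bounded big Hankel operators $\Gamma:H^2(\mathbb T^2)\to H^2(\mathbb T^2)^\perp$ for which there is no $\varphi\in L^\infty(\mathbb T^2)$ with $\Gamma=\Gamma_\varphi$.
   Context: $\mathbb T=\mathbb R/2\pi\mathbb Z$ carries normalized Lebesgue measure. $H^2(\mathbb T^2)=\{f\in L^2(\mathbb T^2):\hat f(m,n)=0 \text{ unless } m,n\ge0\}$, $P$ is the orthogonal projection of $L^2$ onto $H^2(\mathbb T^2)$, and $H^2(\mathbb T^2)^\perp=L^2\ominus H^2(\mathbb T^2)$. A big Hankel operator is a linear map $\Gamma$ from the analytic trigonometric polynomials into $H^2(\mathbb T^2)^\perp$ satisfying $\Gamma(S_kf)=(I-P)(S_k\Gamma f)$ for $k=1,2$, where $S_1f=e^{ix}f$ and $S_2f=e^{iy}f$. Equivalently, $\Gamma=\Gamma_\phi$ for some $\phi\in L^2(\mathbb T^2)$, where $\Gamma_\phi f=(I-P)(\phi f)$; such a $\phi$ is called a symbol of $\Gamma$. The operator $\Gamma$ is bounded if $\sup\|\Gamma f\|_2/\|f\|_2<\infty$, in which case it extends to $H^2(\mathbb T^2)$. *)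

theory Defs
  imports "HOL-Analysis.Analysis"
begin

text \<open>The torus T^2 is modelled by the fundamental domain [0,2pi] x [0,2pi] with
  normalized Lebesgue measure; functions on T^2 are functions real x real => complex
  (only their values on the fundamental domain matter, up to null sets).\<close>

definition T2 :: "(real \<times> real) measure" where
  "T2 = scale_measure (ennreal (1 / (4 * pi\<^sup>2)))
          (restrict_space lborel ({0..2*pi} \<times> {0..2*pi}))"

definition L2 :: "(real \<times> real \<Rightarrow> complex) set" where
  "L2 = {f. f \<in> borel_measurable T2 \<and> integrable T2 (\<lambda>z. (cmod (f z))\<^sup>2)}"

definition Linf :: "(real \<times> real \<Rightarrow> complex) set" where
  "Linf = {f. f \<in> borel_measurable T2 \<and> (\<exists>B. AE z in T2. cmod (f z) \<le> B)}"

definition L2norm :: "(real \<times> real \<Rightarrow> complex) \<Rightarrow> real" where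
  "L2norm f = sqrt (LINT z|T2. (cmod (f z))\<^sup>2)"

definition fcoeff :: "(real \<times> real \<Rightarrow> complex) \<Rightarrow> int \<Rightarrow> int \<Rightarrow> complex" where
  "fcoeff f m n = (LINT z|T2. f z * cis (- (of_int m * fst z + of_int n * snd z)))"

definition H2 :: "(real \<times> real \<Rightarrow> complex) set" where
  "H2 = {f \<in> L2. \<forall>m n. \<not> (m \<ge> 0 \<and> n \<ge> 0) \<longrightarrow> fcoeff f m n = 0}"

definition H2perp :: "(real \<times> real \<Rightarrow> complex) set" where
  "H2perp = {g \<in> L2. \<forall>h \<in> H2. (LINT z|T2. g z * cnj (h z)) = 0}"

definition ATP :: "(real \<times> real \<Rightarrow> complex) set" where
  "ATP = {f. \<exists>(c :: nat \<Rightarrow> nat \<Rightarrow> complex) N.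
            f = (\<lambda>z. \<Sum>j\<le>N. \<Sum>k\<le>N. c j k * cis (real j * fst z + real k * snd z))}"

text \<open>\<open>hankel_val \<phi> f g\<close>: g is (a representative of) \<open>\<Gamma>_\<phi> f = (I - P)(\<phi> f)\<close>,
  i.e. the component of \<open>\<phi> f\<close> in \<open>H^2\<^sup>\<bottom>\<close> in the orthogonal decomposition
  \<open>L^2 = H^2 \<oplus> H^2\<^sup>\<bottom>\<close>.\<close>
definition hankel_val ::
  "(real \<times> real \<Rightarrow> complex) \<Rightarrow> (real \<times> real \<Rightarrow> complex) \<Rightarrow> (real \<times> real \<Rightarrow> complex) \<Rightarrow> bool" where
  "hankel_val \<phi> f g \<longleftrightarrow> g \<in> H2perp \<and> (\<lambda>z. \<phi> z * f z - g z) \<in> H2"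

end

theory Submission
  imports Defs "HOL-Complex_Analysis.Cauchy_Integral_Theorem"
begin

text \<open>Take \<open>\<phi> = - Ln (1 - w)\<close> with \<open>w = e\<^sup>i\<^sup>(\<^sup>x\<^sup>-\<^sup>y\<^sup>)\<close>, whose Fourier coefficients are \<open>1/k\<close>
  at \<open>(k, -k)\<close> for \<open>k \<ge> 1\<close> and zero elsewhere. The function \<open>\<phi> - cnj \<phi> = 2 i Im \<phi>\<close> is bounded, while
  \<open>\<phi>\<close> is analytic in \<open>x\<close> and \<open>cnj \<phi>\<close> is analytic in \<open>y\<close>. Hence \<open>\<Gamma>\<^sub>\<phi> f\<close> is the part of
  \<open>(\<phi> - cnj \<phi>) f\<close> orthogonal to the functions analytic in \<open>y\<close>, so \<open>\<Gamma>\<^sub>\<phi>\<close> is bounded. Every symbol has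
  the same Fourier coefficients as \<open>\<phi>\<close> at all \<open>(k, -k)\<close> with \<open>k \<noteq> 0\<close>; for a bounded symbol the
  Fejer means of the resulting one-sided series \<open>\<Sum> w\<^sup>k / k\<close> at \<open>w = 1\<close> would be bounded, contradicting
  the divergence of the harmonic series.\<close>

subsection \<open>Characters and integration on the torus\<close>

definition chr :: "int \<Rightarrow> int \<Rightarrow> real \<times> real \<Rightarrow> complex" where
  "chr m n z = cis (of_int m * fst z + of_int n * snd z)"

lemma chr_mult: "chr m n z * chr m' n' z = chr (m + m') (n + n') z"
  by (simp add: chr_def cis_mult algebra_simps)

lemma cnj_chr: "cnj (chr m n z) = chr (- m) (- n) z"
  by (simp add: chr_def cis_cnj)

lemma norm_chr [simp]: "cmod (chr m n z) = 1"
  by (simp add: chr_def)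

lemma continuous_on_chr: "continuous_on S (chr m n)"
  unfolding chr_def by (intro continuous_intros)

lemma fcoeff_eq: "fcoeff f m n = (LINT z|T2. f z * chr (- m) (- n) z)"
  by (simp add: fcoeff_def chr_def algebra_simps)

lemma sets_T2: "sets T2 = sets (restrict_space borel ({0..2*pi} \<times> {0..2*pi}))"
  by (simp add: T2_def sets_restrict_space)

lemma borel_measurable_T2: "f \<in> borel_measurable borel \<Longrightarrow> f \<in> borel_measurable T2"
  using measurable_cong_sets[OF sets_T2 refl] measurable_restrict_space1 by blast

lemma chr_measurable [measurable]: "chr m n \<in> borel_measurable T2"
  by (intro borel_measurable_T2 borel_measurable_continuous_onI continuous_on_chr)

lemma square_borel: "{0..2*pi} \<times> {0..2*pi} = cbox (0, 0) (2*pi, 2*pi)"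
  by (simp add: cbox_Pair_eq)

text \<open>In this form the rules for integrals and almost-everywhere statements over a density
  apply.\<close>

lemma T2_density: "T2 = density (restrict_space lborel ({0..2*pi} \<times> {0..2*pi})) (\<lambda>_. ennreal (1 / (4 * pi\<^sup>2)))"
  unfolding T2_def by (rule measure_eqI) (auto simp: emeasure_density_const)

lemma integral_T2:
  fixes f :: "real \<times> real \<Rightarrow> complex"
  assumes "continuous_on UNIV f"
  shows "(LINT z|T2. f z) = (1 / (4 * pi\<^sup>2)) *\<^sub>R
     integral {0..2*pi} (\<lambda>x. integral {0..2*pi} (\<lambda>y. f (x, y)))"
proof -
  let ?S = "cbox (0, 0) (2*pi, 2*pi :: real)"
  have f: "continuous_on ?S f" using assms continuous_on_subset by blast
  have fm: "f \<in> borel_measurable borel"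
    using assms by (rule borel_measurable_continuous_onI)
  have "(LINT z|T2. f z) = (LINT z|restrict_space lborel ?S. (1 / (4 * pi\<^sup>2)) *\<^sub>R f z)"
    unfolding T2_density square_borel
    by (intro integral_density) (auto intro!: measurable_restrict_space1 fm)
  also have "\<dots> = (1 / (4 * pi\<^sup>2)) *\<^sub>R (LINT z:?S|lborel. f z)"
    by (simp add: integral_restrict_space set_lebesgue_integral_def)
  also have "(LINT z:?S|lborel. f z) = integral ?S f"
    by (intro set_borel_integral_eq_integral)
       (simp add: set_integrable_def borel_integrable_compact f)
  also have "\<dots> = integral {0..2*pi} (\<lambda>x. integral {0..2*pi} (\<lambda>y. f (x, y)))"
    using integral_prod_continuous[OF f] by simp
  finally show ?thesis .
qed

lemma integral_cis: "integral {0..2*pi} (\<lambda>x. cis (of_int m * x)) = (if m = 0 then 2 * pi else 0)"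
proof (cases "m = 0")
  case False
  have "((\<lambda>x. cis (of_int m * x)) has_integral
      cis (of_int m * (2*pi)) / (\<i> * of_int m) - cis (of_int m * 0) / (\<i> * of_int m)) {0..2*pi}"
  proof (rule fundamental_theorem_of_calculus)
    fix x :: real
    have "((\<lambda>x. exp (\<i> * of_int m * of_real x) / (\<i> * of_int m)) has_vector_derivative 
        exp (\<i> * of_int m * of_real x)) (at x within {0..2*pi})"
      using False
      by (auto intro!: derivative_eq_intros has_vector_derivative_real_field)
    then show "((\<lambda>x. cis (of_int m * x) / (\<i> * of_int m)) has_vector_derivative 
        cis (of_int m * x)) (at x within {0..2*pi})"
      by (simp add: cis_conv_exp mult_ac)
  qed auto
  moreover have "cis (of_int m * (2*pi)) = 1"
    using cis_multiple_2pi[of "of_int m"] by (simp add: mult_ac)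
  ultimately show ?thesis using False by (simp add: integral_unique)
qed (simp add: scaleR_conv_of_real)

lemma integral_chr: "(LINT z|T2. chr m n z) = (if m = 0 \<and> n = 0 then 1 else 0)"
proof -
  have "integral {0..2*pi} (\<lambda>x. integral {0..2*pi} (\<lambda>y. chr m n (x, y))) =
      integral {0..2*pi} (\<lambda>x. cis (of_int m * x)) * integral {0..2*pi} (\<lambda>y. cis (of_int n * y))"
    by (simp add: chr_def flip: cis_mult)
  then have eq: "(LINT z|T2. chr m n z) = (1 / (4 * pi\<^sup>2)) *\<^sub>R
      ((if m = 0 then 2 * pi else 0) * (if n = 0 then 2 * pi else 0) :: complex)"
    unfolding integral_T2[OF continuous_on_chr] integral_cis of_real_def by simp
  show ?thesis
  proof (cases "m = 0 \<and> n = 0")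
    case True
    have "(1 / (4 * pi\<^sup>2)) * (2 * pi * (2 * pi)) = 1"
      by (simp add: power2_eq_square)
    then show ?thesis
      using True unfolding eq scaleR_conv_of_real by (simp flip: of_real_mult)
  qed (auto simp: eq)
qed

lemma prob_T2: "emeasure T2 (space T2) = 1"
proof -
  let ?S = "cbox (0, 0) (2*pi, 2*pi) :: (real \<times> real) set"
  define c where "c = 1 / (4 * pi\<^sup>2)"
  have "prod ((\<bullet>) ((2*pi, 2*pi) - (0, 0 :: real))) Basis = 4 * pi\<^sup>2"
    by (simp add: Basis_prod_def power2_eq_square)
  then have "emeasure lborel ?S = ennreal (4 * pi\<^sup>2)"
    by (subst emeasure_lborel_cbox) (auto simp: Basis_prod_def)
  moreover have "space T2 = ?S"
    unfolding T2_def square_borel by (simp add: space_scale_measure space_restrict_space)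
  moreover have "emeasure T2 ?S = ennreal c * emeasure lborel ?S"
    unfolding T2_def square_borel c_def[symmetric] emeasure_scale_measure
    by (subst emeasure_restrict_space) (rule sets.Int_space_eq1 | simp)+
  ultimately have "emeasure T2 (space T2) = ennreal c * ennreal (4 * pi\<^sup>2)"
    by metis
  also have "\<dots> = ennreal (c * (4 * pi\<^sup>2))"
    by (rule ennreal_mult'[symmetric]) (simp add: c_def)
  also have "c * (4 * pi\<^sup>2) = 1"
    by (simp add: c_def)
  finally show ?thesis by simp
qed

interpretation T2: finite_measure T2
  by (rule finite_measureI) (simp add: prob_T2)

text \<open>The exceptional set lies in the countably many lines x - y = 2 pi k, each a null set. It
  is the singular set of \<open>logsym\<close>, so pointwise estimates can be confined to its
  complement.\<close>

lemma AE_T2_chr_neq_1: "AE z in T2. chr 1 (-1) z \<noteq> 1"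
proof -
  let ?N = "\<lambda>c::real. {z :: real \<times> real. (1, -1) \<bullet> z = c}"
  have null: "?N c \<in> null_sets lborel" for c
  proof -
    have "closed (?N c)" by (rule closed_hyperplane)
    then have "?N c \<in> sets borel" by (rule borel_closed)
    moreover have "negligible (?N c)"
      by (rule negligible_hyperplane) (simp add: prod_eq_iff)
    ultimately show ?thesis
      by (simp add: negligible_iff_null_sets null_sets_completion_iff)
  qed
  have "AE z in lborel. \<forall>k::int. z \<notin> ?N (of_int k * (2 * pi))"
    unfolding AE_all_countable using null by (intro allI AE_not_in)
  then have "AE z in lborel. chr 1 (-1) z \<noteq> 1"
  proof eventually_elim
    case (elim z)
    show ?case
    proof
      assume "chr 1 (-1) z = 1"
      then have "cos (fst z - snd z) = 1"
        by (simp add: chr_def complex_eq_iff)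
      then obtain k :: int where "fst z - snd z = of_int k * 2 * pi"
        unfolding cos_one_2pi_int by blast
      then have "z \<in> ?N (of_int k * (2 * pi))"
        by (cases z) (simp add: mult_ac)
      then show False using elim by blast
    qed
  qed
  then have "AE z in restrict_space lborel (cbox (0, 0) (2*pi, 2*pi)). chr 1 (-1) z \<noteq> 1"
    by (subst AE_restrict_space_iff) (auto elim: eventually_mono)
  then show ?thesis
    unfolding T2_density square_borel by (simp add: AE_density)
qed

subsection \<open>Square integrable functions\<close>

lemma L2_measurable: "f \<in> L2 \<Longrightarrow> f \<in> borel_measurable T2"
  by (simp add: L2_def)

lemma L2_mult_integrable:
  assumes "f \<in> L2" "g \<in> L2"
  shows "integrable T2 (\<lambda>z. f z * g z)"
proof (rule Bochner_Integration.integrable_bound)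
  show "integrable T2 (\<lambda>z. (cmod (f z))\<^sup>2 + (cmod (g z))\<^sup>2)"
    using assms by (auto simp: L2_def)
  show "(\<lambda>z. f z * g z) \<in> borel_measurable T2"
    using assms by (auto simp: L2_def)
  have "cmod (f z * g z) \<le> (cmod (f z))\<^sup>2 + (cmod (g z))\<^sup>2" for z
    using sum_squares_bound[of "cmod (f z)" "cmod (g z)"]
      mult_nonneg_nonneg[OF norm_ge_zero norm_ge_zero, of "f z" "g z"]
    unfolding norm_mult by linarith
  then show "AE z in T2. norm (f z * g z) \<le> norm ((cmod (f z))\<^sup>2 + (cmod (g z))\<^sup>2)"
    by (intro AE_I2) (simp add: abs_of_nonneg)
qed

lemma L2_mult_bounded:
  assumes "f \<in> L2" and [measurable]: "g \<in> borel_measurable T2" and B: "AE z in T2. cmod (g z) \<le> B"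
  shows "(\<lambda>z. f z * g z) \<in> L2"
proof -
  have [measurable]: "f \<in> borel_measurable T2" using assms(1) by (rule L2_measurable)
  have "integrable T2 (\<lambda>z. (cmod (f z * g z))\<^sup>2)"
  proof (rule Bochner_Integration.integrable_bound)
    show "integrable T2 (\<lambda>z. B\<^sup>2 * (cmod (f z))\<^sup>2)"
      using assms(1) by (auto simp: L2_def)
    show "AE z in T2. norm ((cmod (f z * g z))\<^sup>2) \<le> norm (B\<^sup>2 * (cmod (f z))\<^sup>2)"
      using B
    proof eventually_elim
      case (elim z)
      then have "(cmod (g z))\<^sup>2 \<le> B\<^sup>2" by (intro power_mono) auto
      then show ?case
        by (simp add: norm_mult power_mult_distrib mult.commute[of _ "(cmod (g z))\<^sup>2"] mult_right_mono)
    qed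
  qed measurable
  then show ?thesis by (simp add: L2_def)
qed

lemma L2_add:
  assumes "f \<in> L2" "g \<in> L2"
  shows "(\<lambda>z. f z + g z) \<in> L2"
proof -
  have [measurable]: "f \<in> borel_measurable T2" "g \<in> borel_measurable T2"
    using assms by (auto intro: L2_measurable)
  have "integrable T2 (\<lambda>z. (cmod (f z + g z))\<^sup>2)"
  proof (rule Bochner_Integration.integrable_bound)
    show "integrable T2 (\<lambda>z. 2 * (cmod (f z))\<^sup>2 + 2 * (cmod (g z))\<^sup>2)"
      using assms by (auto simp: L2_def)
    have "(cmod (f z + g z))\<^sup>2 \<le> 2 * (cmod (f z))\<^sup>2 + 2 * (cmod (g z))\<^sup>2" for z
    proof -
      have "(cmod (f z + g z))\<^sup>2 \<le> (cmod (f z) + cmod (g z))\<^sup>2"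
        by (intro power_mono norm_triangle_ineq) auto
      also have "\<dots> \<le> 2 * (cmod (f z))\<^sup>2 + 2 * (cmod (g z))\<^sup>2"
        using sum_squares_bound[of "cmod (f z)" "cmod (g z)"] by (simp add: power2_sum)
      finally show ?thesis .
    qed
    then show "AE z in T2. norm ((cmod (f z + g z))\<^sup>2) \<le> norm (2 * (cmod (f z))\<^sup>2 + 2 * (cmod (g z))\<^sup>2)"
      by (intro AE_I2) (simp add: abs_of_nonneg)
  qed measurable
  then show ?thesis by (simp add: L2_def)
qed

lemma L2_bounded:
  assumes "f \<in> borel_measurable T2" "AE z in T2. cmod (f z) \<le> B"
  shows "f \<in> L2"
proof -
  have "(\<lambda>_. 1) \<in> L2" by (simp add: L2_def)
  from L2_mult_bounded[OF this assms] show ?thesis by simp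
qed

lemma L2_chr: "chr m n \<in> L2"
  by (rule L2_bounded[where B = 1]) auto

lemma L2_cmult: "f \<in> L2 \<Longrightarrow> (\<lambda>z. c * f z) \<in> L2"
  using L2_mult_bounded[of f "\<lambda>_. c" "cmod c"] by (simp add: mult.commute)

lemma L2_mult_chr: "f \<in> L2 \<Longrightarrow> (\<lambda>z. f z * chr m n z) \<in> L2"
  by (rule L2_mult_bounded[where B = 1]) auto

lemma L2_diff: "f \<in> L2 \<Longrightarrow> g \<in> L2 \<Longrightarrow> (\<lambda>z. f z - g z) \<in> L2"
  using L2_add[of f "\<lambda>z. - 1 * g z"] L2_cmult[of g "-1"] by simp

lemma L2_cnj: "f \<in> L2 \<Longrightarrow> (\<lambda>z. cnj (f z)) \<in> L2"
  unfolding L2_def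
  using measurable_compose[OF _ borel_measurable_continuous_onI[OF continuous_on_cnj[OF continuous_on_id]]]
  by auto

lemma L2_sum: "(\<And>i. i \<in> I \<Longrightarrow> f i \<in> L2) \<Longrightarrow> (\<lambda>z. \<Sum>i\<in>I. f i z) \<in> L2"
proof (induction I rule: infinite_finite_induct)
  case (insert i I)
  then show ?case using L2_add[of "f i" "\<lambda>z. \<Sum>i\<in>I. f i z"] by simp
qed (simp_all add: L2_def)

lemma L2_integrable: "f \<in> L2 \<Longrightarrow> integrable T2 f"
  using L2_mult_integrable[OF _ L2_chr, of f 0 0] by (simp add: chr_def)

lemma chr_diag: "chr (int l) (- int l) z = chr 1 (-1) z ^ l"
  using Complex.DeMoivre[of "fst z - snd z" l] by (simp add: chr_def right_diff_distrib)

subsection \<open>The logarithmic symbol\<close>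

definition logsym :: "real \<times> real \<Rightarrow> complex" where
  "logsym z = - Ln (1 - chr 1 (-1) z)"

text \<open>Abel means of the Fourier series of \<open>logsym\<close>. For 0 <= r < 1 the series
  converges absolutely and uniformly, which permits termwise integration before r tends to
  1.\<close>

definition logsym_abel :: "real \<Rightarrow> real \<times> real \<Rightarrow> complex" where
  "logsym_abel r z = - Ln (1 - of_real r * chr 1 (-1) z)"

lemma logsym_abel_sums:
  assumes "0 \<le> r" "r < 1"
  \<comment> \<open>The sum may start at l = 0: division by zero yields 0, so that term
    vanishes.\<close>
  shows "(\<lambda>l. of_real (r ^ l / real l) * chr (int l) (- int l) z) sums logsym_abel r z"
proof -
  have "cmod (- (of_real r * chr 1 (-1) z)) < 1"
    using assms by (simp add: norm_mult)
  from sums_minus[OF Ln_series'[OF this]] show ?thesis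
    by (simp add: logsym_abel_def chr_diag power_mult_distrib)
qed

text \<open>A point of the closed unit disc with real part at least 1 must be 1 itself. Hence 1 - u
  avoids the branch cut of \<open>Ln\<close> and has argument below pi/2 in modulus; the first fact
  gives continuity, the second the bound on the imaginary part.\<close>

lemma Re_one_minus_pos:
  assumes "cmod u \<le> 1" "u \<noteq> 1"
  shows "0 < Re (1 - u)"
proof (rule ccontr)
  assume "\<not> 0 < Re (1 - u)"
  moreover have "Re u \<le> cmod u" by (rule complex_Re_le_cmod)
  ultimately have "Re u = 1" "cmod u = 1" using assms by auto
  then have "Im u = 0" by (simp add: cmod_def)
  then show False using \<open>Re u = 1\<close> assms by (simp add: complex_eq_iff)
qed

lemma abs_Im_Ln_one_minus: "cmod u \<le> 1 \<Longrightarrow> u \<noteq> 1 \<Longrightarrow> \<bar>Im (Ln (1 - u))\<bar> < 2"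
  using Re_Ln_pos_lt_imp[OF Re_one_minus_pos, of u] pi_less_4 by simp

lemma measurable_logsym [measurable]: "logsym \<in> borel_measurable T2"
  unfolding logsym_def by measurable

lemma measurable_logsym_abel [measurable]: "logsym_abel r \<in> borel_measurable T2"
  unfolding logsym_abel_def by measurable

text \<open>Supplies an r-independent majorant for dominated convergence. Since 1 - r <= |1 - r u|,
  the triangle inequality gives |1 - u| <= 2 |1 - r u|, so the logarithm of the modulus grows by at
  most 1; the imaginary part adds at most 2, whence the constant 3.\<close>

lemma logsym_abel_le:
  assumes "0 \<le> r" "r < 1" and ne: "chr 1 (-1) z \<noteq> 1"
  shows "cmod (logsym_abel r z) \<le> cmod (logsym z) + 3"
proof -
  define u where "u = chr 1 (-1) z"
  have u: "cmod u = 1" "u \<noteq> 1" using ne by (auto simp: u_def)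
  have ru: "cmod (of_real r * u) < 1" using assms u by (simp add: norm_mult)
  then have nz: "1 - of_real r * u \<noteq> 0" by auto
  define a where "a = cmod (1 - of_real r * u)"
  define b where "b = cmod (1 - u)"
  have a: "0 < a" "a \<le> 2"
    using nz norm_triangle_ineq4[of 1 "of_real r * u"] ru by (auto simp: a_def)
  have b: "0 < b" using u by (simp add: b_def)
  have "b \<le> cmod (1 - of_real r * u) + cmod (of_real r * u - u)"
    unfolding b_def using norm_triangle_ineq[of "1 - of_real r * u" "of_real r * u - u"] by simp
  also have "cmod (of_real r * u - u) = 1 - r"
  proof -
    have "of_real r * u - u = of_real (r - 1) * u" by (simp add: algebra_simps)
    then show ?thesis using u assms by (simp only: norm_mult norm_of_real) simp
  qed
  also have "1 - r \<le> a"
    using norm_triangle_ineq2[of 1 "of_real r * u"] u assms by (simp add: a_def norm_mult)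
  finally have ba: "b \<le> 2 * a" by (simp add: a_def)
  have ln2: "ln 2 \<le> (1::real)" using ln_le_minus_one[of 2] by simp
  \<comment> \<open>The bound a <= 2 controls \<open>ln a\<close> from above and b <= 2 a controls
    it from below; each costs at most ln 2 <= 1.\<close>
  have "ln a \<le> ln 2" using a by simp
  moreover have "ln b \<le> ln 2 + ln a"
    using ba a b by (simp flip: ln_mult_pos)
  ultimately have ab: "\<bar>ln a\<bar> \<le> \<bar>ln b\<bar> + 1" using ln2 by linarith
  have "cmod (logsym_abel r z) \<le> \<bar>Re (Ln (1 - of_real r * u))\<bar> + \<bar>Im (Ln (1 - of_real r * u))\<bar>"
    unfolding logsym_abel_def u_def norm_minus_cancel by (rule cmod_le)
  also have "\<dots> \<le> \<bar>ln a\<bar> + 2"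
    using abs_Im_Ln_one_minus[of "of_real r * u"] ru nz by (simp add: a_def)
  also have "\<dots> \<le> \<bar>ln b\<bar> + 3" using ab by simp
  also have "\<bar>ln b\<bar> \<le> cmod (logsym z)"
    using abs_Re_le_cmod[of "Ln (1 - u)"] u by (simp add: logsym_def b_def u_def)
  finally show ?thesis by simp
qed

lemma logsym_abel_tendsto:
  assumes "chr 1 (-1) z \<noteq> 1" "r \<longlonglongrightarrow> 1"
  shows "(\<lambda>n. logsym_abel (r n) z) \<longlonglongrightarrow> logsym z"
proof -
  have "0 < Re (1 - chr 1 (-1) z)" using assms by (intro Re_one_minus_pos) auto
  then have "1 - chr 1 (-1) z \<notin> \<real>\<^sub>\<le>\<^sub>0" by (auto simp: complex_nonpos_Reals_iff)
  then have "(\<lambda>n. - Ln (1 - of_real (r n) * chr 1 (-1) z)) \<longlonglongrightarrow> - Ln (1 - of_real 1 * chr 1 (-1) z)"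
    by (intro tendsto_intros assms) auto
  then show ?thesis by (simp add: logsym_def logsym_abel_def)
qed

text \<open>Comparison with the geometric series. The bound is not uniform in r and serves only to
  place each Abel mean in L^2.\<close>

lemma logsym_abel_bounded:
  assumes "0 \<le> r" "r < 1"
  shows "cmod (logsym_abel r z) \<le> 1 / (1 - r)"
proof -
  have "r ^ l / real l \<le> r ^ l" for l
    using assms by (cases "l = 0") (auto simp: divide_le_eq mult_le_cancel_left1)
  then have "cmod (of_real (r ^ l / real l) * chr (int l) (- int l) z) \<le> r ^ l" for l
    using assms by (simp add: norm_mult norm_divide norm_power)
  then have "cmod (\<Sum>l. of_real (r ^ l / real l) * chr (int l) (- int l) z) \<le> (\<Sum>l. r ^ l)"
    using assms by (intro norm_suminf_le) (auto simp: summable_geometric)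
  also have "\<dots> = 1 / (1 - r)" using assms by (simp add: suminf_geometric)
  finally show ?thesis
    using sums_unique[OF logsym_abel_sums[OF assms, of z]] by simp
qed

text \<open>Sum and integral may be exchanged because the norms are r^l / l times |h|, and these
  coefficients are summable for r < 1.\<close>

lemma logsym_abel_mult_sums:
  assumes "0 \<le> r" "r < 1" and h: "integrable T2 h"
  shows "(\<lambda>l. of_real (r ^ l / real l) * (LINT z|T2. chr (int l) (- int l) z * h z))
    sums (LINT z|T2. logsym_abel r z * h z)"
proof -
  let ?f = "\<lambda>l z. of_real (r ^ l / real l) * (chr (int l) (- int l) z * h z)"
  have int: "integrable T2 (\<lambda>z. chr (int l) (- int l) z * h z)" for l
    using h by (rule Bochner_Integration.integrable_bound) (use h in \<open>auto simp: norm_mult\<close>)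
  have nonneg: "0 \<le> r ^ l / real l" for l
    using assms by simp
  have le: "r ^ l / real l \<le> r ^ l" for l
    using assms by (cases "l = 0") (auto simp: divide_le_eq mult_le_cancel_left1)
  have n: "cmod (?f l z) = r ^ l / real l * cmod (h z)" for l z
    unfolding norm_mult norm_of_real norm_chr abs_of_nonneg[OF nonneg] by simp
  have s: "summable (\<lambda>l. r ^ l / real l)"
    by (rule summable_comparison_test'[of "\<lambda>l. r ^ l" 0])
       (use assms le in \<open>auto simp: summable_geometric\<close>)
  have "(\<lambda>l. LINT z|T2. ?f l z) sums (LINT z|T2. (\<Sum>l. ?f l z))"
  proof (rule sums_integral)
    show "integrable T2 (?f l)" for l using int by auto
    show "AE z in T2. summable (\<lambda>l. cmod (?f l z))"
      unfolding n by (intro AE_I2 summable_mult2 s)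
    show "summable (\<lambda>l. LINT z|T2. cmod (?f l z))"
      unfolding n integral_mult_right_zero by (intro summable_mult2 s)
  qed
  moreover have "(\<Sum>l. ?f l z) = logsym_abel r z * h z" for z
    using sums_unique[OF sums_mult2[OF logsym_abel_sums[OF assms(1,2)], of z "h z"]]
    by (simp add: mult.assoc)
  ultimately show ?thesis by simp
qed

lemma L2_logsym_abel:
  assumes "0 \<le> r" "r < 1"
  shows "logsym_abel r \<in> L2"
  by (rule L2_bounded[OF measurable_logsym_abel AE_I2]) (rule logsym_abel_bounded[OF assms])

text \<open>Only the frequencies (k + l, -k - l) occur in the product, and k + l > 0, so there is no
  constant term.\<close>

lemma integral_logsym_abel_chr:
  assumes "0 \<le> r" "r < 1" "0 < l"
  shows "(LINT z|T2. chr (int l) (- int l) z * logsym_abel r z) = 0"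
proof -
  have "(\<lambda>k. of_real (r ^ k / real k) * (LINT z|T2. chr (int k) (- int k) z * chr (int l) (- int l) z))
      sums (LINT z|T2. logsym_abel r z * chr (int l) (- int l) z)"
    using assms by (intro logsym_abel_mult_sums L2_integrable L2_chr)
  moreover have "(LINT z|T2. chr (int k) (- int k) z * chr (int l) (- int l) z) = 0" for k
    using assms by (simp add: chr_mult integral_chr)
  ultimately have "(\<lambda>k. 0) sums (LINT z|T2. logsym_abel r z * chr (int l) (- int l) z)"
    by simp
  then show ?thesis by (simp add: sums_iff mult.commute)
qed

text \<open>One factor is expanded in its series. The terms with l > 0 vanish by
  \<open>integral_logsym_abel_chr\<close>; the term l = 0 has coefficient 0.\<close>

lemma integral_logsym_abel_square:
  assumes "0 \<le> r" "r < 1"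
  shows "(LINT z|T2. logsym_abel r z * logsym_abel r z) = 0"
proof -
  have "(\<lambda>l. of_real (r ^ l / real l) * (LINT z|T2. chr (int l) (- int l) z * logsym_abel r z)) = (\<lambda>_. 0)"
  proof
    show "of_real (r ^ l / real l) * (LINT z|T2. chr (int l) (- int l) z * logsym_abel r z) = 0" for l
      using integral_logsym_abel_chr[OF assms, of l] by (cases "l = 0") simp_all
  qed
  with logsym_abel_mult_sums[OF assms L2_integrable[OF L2_logsym_abel[OF assms]]]
  have "(\<lambda>_. 0) sums (LINT z|T2. logsym_abel r z * logsym_abel r z)" by simp
  then show ?thesis using sums_unique2 sums_zero by blast
qed

lemma abs_Im_logsym_abel_le:
  assumes "0 \<le> r" "r < 1"
  shows "\<bar>Im (logsym_abel r z)\<bar> \<le> 2"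
proof -
  have "cmod (of_real r * chr 1 (-1) z) < 1" using assms by (simp add: norm_mult)
  then have "\<bar>Im (Ln (1 - of_real r * chr 1 (-1) z))\<bar> < 2"
    by (intro abs_Im_Ln_one_minus) auto
  then show ?thesis by (simp add: logsym_abel_def)
qed

text \<open>The square of the analytic function \<^term>\<open>logsym_abel r\<close> has mean zero, so its real part
  has the same \<open>L\<^sup>2\<close> norm as its imaginary part, which is bounded uniformly in \<open>r\<close>.\<close>

lemma integral_logsym_abel_le:
  assumes "0 \<le> r" "r < 1"
  shows "(LINT z|T2. (cmod (logsym_abel r z))\<^sup>2) \<le> 8"
proof -
  let ?F = "logsym_abel r"
  have F: "?F \<in> L2" using assms by (rule L2_logsym_abel)
  have i: "integrable T2 (\<lambda>z. ?F z * ?F z)" by (rule L2_mult_integrable[OF F F])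
  have i2: "integrable T2 (\<lambda>z. (cmod (?F z))\<^sup>2)" using F by (simp add: L2_def)
  have "(cmod (?F z))\<^sup>2 - Re (?F z * ?F z) = 2 * (Im (?F z))\<^sup>2" for z
    by (simp add: cmod_power2) (simp add: power2_eq_square)
  moreover have "2 * (Im (?F z))\<^sup>2 \<le> 8" for z
    using power_mono[OF abs_Im_logsym_abel_le[OF assms, of z], of 2] by simp
  ultimately have le: "(cmod (?F z))\<^sup>2 - Re (?F z * ?F z) \<le> 8" for z by metis
  have "(LINT z|T2. (cmod (?F z))\<^sup>2) = (LINT z|T2. (cmod (?F z))\<^sup>2 - Re (?F z * ?F z))"
    using integral_logsym_abel_square[OF assms] i i2
    by (subst Bochner_Integration.integral_diff) (auto simp del: times_complex.sel)
  also have "\<dots> \<le> (LINT z|T2. 8)"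
    using i i2 le by (intro integral_mono) (auto simp del: times_complex.sel)
  also have "\<dots> = 8" by (simp add: measure_def prob_T2)
  finally show ?thesis .
qed

section \<open>Passage to the limit r -> 1\<close>

definition abel_seq :: "nat \<Rightarrow> real" where
  "abel_seq n = 1 - inverse (real (Suc n))"

lemma abel_seq: "0 \<le> abel_seq n" "abel_seq n < 1" "abel_seq \<longlonglongrightarrow> 1"
proof -
  show "0 \<le> abel_seq n" "abel_seq n < 1" by (auto simp: abel_seq_def inverse_le_1_iff)
  show "abel_seq \<longlonglongrightarrow> 1"
    unfolding abel_seq_def
    using tendsto_diff[OF tendsto_const LIMSEQ_inverse_real_of_nat, of 1] by simp
qed

text \<open>Fatou's lemma along \<open>abel_seq\<close>: the Abel means converge almost everywhere
  to \<open>logsym\<close>, and their squared L^2 norms are at most 8.\<close>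

lemma L2_logsym: "logsym \<in> L2"
proof -
  let ?F = "\<lambda>n z. ennreal ((cmod (logsym_abel (abel_seq n) z))\<^sup>2)"
  have "(\<integral>\<^sup>+ z. ennreal ((cmod (logsym z))\<^sup>2) \<partial>T2) = (\<integral>\<^sup>+ z. liminf (\<lambda>n. ?F n z) \<partial>T2)"
  proof (rule nn_integral_cong_AE)
    show "AE z in T2. ennreal ((cmod (logsym z))\<^sup>2) = liminf (\<lambda>n. ?F n z)"
      using AE_T2_chr_neq_1
    proof eventually_elim
      case (elim z)
      have "(\<lambda>n. ?F n z) \<longlonglongrightarrow> ennreal ((cmod (logsym z))\<^sup>2)"
        by (intro tendsto_intros logsym_abel_tendsto elim abel_seq)
      then show ?case by (intro lim_imp_Liminf[symmetric]) auto
    qed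
  qed
  also have "\<dots> \<le> liminf (\<lambda>n. \<integral>\<^sup>+ z. ?F n z \<partial>T2)"
    by (rule nn_integral_liminf) measurable
  also have "\<dots> \<le> 8"
  proof -
    have "(\<integral>\<^sup>+ z. ?F n z \<partial>T2) \<le> 8" for n
    proof -
      have "(\<integral>\<^sup>+ z. ?F n z \<partial>T2) = ennreal (LINT z|T2. (cmod (logsym_abel (abel_seq n) z))\<^sup>2)"
        using L2_logsym_abel[OF abel_seq(1,2)]
        by (intro nn_integral_eq_integral) (auto simp: L2_def)
      also have "\<dots> \<le> ennreal 8"
        by (intro ennreal_leI integral_logsym_abel_le abel_seq)
      finally show ?thesis by simp
    qed
    then have "liminf (\<lambda>n. \<integral>\<^sup>+ z. ?F n z \<partial>T2) \<le> liminf (\<lambda>n. 8)"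
      by (intro Liminf_mono) auto
    then show ?thesis by (simp add: Liminf_const)
  qed
  also have "\<dots> < \<infinity>" by simp
  finally have "integrable T2 (\<lambda>z. (cmod (logsym z))\<^sup>2)"
    by (intro integrableI_bounded) auto
  then show ?thesis by (simp add: L2_def)
qed

text \<open>The hypothesis \<open>zero\<close> truncates the series at k for all r at once, so the
  limit r -> 1 of the sum is elementary. The integral converges by dominated convergence with the
  majorant from \<open>logsym_abel_le\<close>.\<close>

lemma integral_logsym_mult:
  assumes h: "h \<in> L2"
    and zero: "\<And>l. k < l \<Longrightarrow> (LINT z|T2. chr (int l) (- int l) z * h z) = 0"
  shows "(LINT z|T2. logsym z * h z) =
    (\<Sum>l=1..k. (LINT z|T2. chr (int l) (- int l) z * h z) / of_nat l)"
proof -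
  let ?c = "\<lambda>l. LINT z|T2. chr (int l) (- int l) z * h z"
  have hm [measurable]: "h \<in> borel_measurable T2" using h by (rule L2_measurable)
  have "(\<lambda>n. LINT z|T2. logsym_abel (abel_seq n) z * h z) \<longlonglongrightarrow> (LINT z|T2. logsym z * h z)"
  proof (rule integral_dominated_convergence)
    show "integrable T2 (\<lambda>z. cmod (logsym z * h z) + 3 * cmod (h z))"
      using L2_mult_integrable[OF L2_logsym h] L2_integrable[OF h] by auto
    show "AE z in T2. (\<lambda>n. logsym_abel (abel_seq n) z * h z) \<longlonglongrightarrow> logsym z * h z"
      using AE_T2_chr_neq_1
      by eventually_elim (intro tendsto_intros logsym_abel_tendsto abel_seq)
    show "AE z in T2. cmod (logsym_abel (abel_seq n) z * h z) \<le> cmod (logsym z * h z) + 3 * cmod (h z)" for n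
      using AE_T2_chr_neq_1
    proof eventually_elim
      case (elim z)
      show ?case
        using mult_right_mono[OF logsym_abel_le[OF abel_seq(1,2) elim, of n], of "cmod (h z)"]
        by (simp add: norm_mult algebra_simps)
    qed
  qed measurable
  moreover have "(\<lambda>n. LINT z|T2. logsym_abel (abel_seq n) z * h z) =
      (\<lambda>n. \<Sum>l=1..k. of_real (abel_seq n ^ l / real l) * ?c l)"
  proof
    fix n
    \<comment> \<open>Terms beyond k vanish by \<open>zero\<close>, the one at l = 0 by division by
      zero.\<close>
    have "(\<lambda>l. of_real (abel_seq n ^ l / real l) * ?c l) sums
        (\<Sum>l=1..k. of_real (abel_seq n ^ l / real l) * ?c l)"
      by (rule sums_finite) (auto simp: zero not_le Suc_le_eq)
    from sums_unique2[OF logsym_abel_mult_sums[OF abel_seq(1,2) L2_integrable[OF h]] this]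
    show "(LINT z|T2. logsym_abel (abel_seq n) z * h z) =
      (\<Sum>l=1..k. of_real (abel_seq n ^ l / real l) * ?c l)" .
  qed
  moreover have "(\<lambda>n. \<Sum>l=1..k. of_real (abel_seq n ^ l / real l) * ?c l) \<longlonglongrightarrow>
      (\<Sum>l=1..k. of_real (1 ^ l / real l) * ?c l)"
    by (intro tendsto_intros abel_seq) (auto simp: zero_less_iff_neq_zero)
  ultimately show ?thesis
    using LIMSEQ_unique by fastforce
qed

subsection \<open>The Hankel operator\<close>

text \<open>Integration against \<open>chr a b\<close> reads off the Fourier coefficient at (-a,
  -b), which explains the sign condition on a.\<close>

lemma integral_logsym_chr:
  "(LINT z|T2. logsym z * chr a b z) = (if a < 0 \<and> b = - a then 1 / of_nat (nat (- a)) else 0)"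
proof -
  have *: "(LINT z|T2. chr (int l) (- int l) z * chr a b z) =
      (if int l = - a \<and> int l = b then 1 else 0)" for l
    by (auto simp: chr_mult integral_chr)
  \<comment> \<open>Only l = -a can contribute, so \<open>nat (-a)\<close> is a valid cut-off; for a
    >= 0 it is 0 and the sum is empty.\<close>
  have "(LINT z|T2. logsym z * chr a b z) =
      (\<Sum>l=1..nat (-a). (LINT z|T2. chr (int l) (- int l) z * chr a b z) / of_nat l)"
    by (rule integral_logsym_mult[OF L2_chr]) (unfold *, auto)
  also have "\<dots> = (\<Sum>l=1..nat (-a). if l = nat (-a) then (if a < 0 \<and> b = - a then 1 / of_nat (nat (- a)) else 0) else 0)"
    unfolding * by (intro sum.cong) auto
  also have "\<dots> = (if a < 0 \<and> b = - a then 1 / of_nat (nat (- a)) else 0)"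
    by (subst sum.delta) auto
  finally show ?thesis .
qed

text \<open>The terms of frequency (l, -l) with l > k. These are exactly the ones that a monomial of
  second degree k carries to a negative second frequency k - l.\<close>

definition logsym_tail :: "nat \<Rightarrow> real \<times> real \<Rightarrow> complex" where
  "logsym_tail k z = logsym z - (\<Sum>l=1..k. chr (int l) (- int l) z / of_nat l)"

lemma L2_logsym_tail: "logsym_tail k \<in> L2"
  unfolding logsym_tail_def
  using L2_cmult[OF L2_chr] by (intro L2_diff L2_logsym L2_sum) (simp add: divide_inverse mult.commute)

text \<open>By \<open>integral_logsym_mult\<close> the subtracted partial sum accounts for the whole
  pairing of \<open>logsym\<close> with such an h.\<close>

lemma integral_logsym_tail_mult:
  assumes h: "h \<in> L2"
    and zero: "\<And>l. k < l \<Longrightarrow> (LINT z|T2. chr (int l) (- int l) z * h z) = 0"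
  shows "(LINT z|T2. logsym_tail k z * h z) = 0"
proof -
  have "logsym_tail k z * h z =
      logsym z * h z - (\<Sum>l=1..k. chr (int l) (- int l) z * h z / of_nat l)" for z
    by (simp add: logsym_tail_def left_diff_distrib sum_distrib_right)
  then show ?thesis
    using L2_mult_integrable[OF L2_logsym h] L2_mult_integrable[OF L2_chr h]
    by (simp add: integral_logsym_mult[OF h zero])
qed

section \<open>Splitting the product of the symbol with an analytic polynomial\<close>

lemma H2_L2: "f \<in> H2 \<Longrightarrow> f \<in> L2"
  by (simp add: H2_def)

lemma H2_chr: "0 \<le> a \<Longrightarrow> 0 \<le> b \<Longrightarrow> chr a b \<in> H2"
  by (auto simp: H2_def L2_chr fcoeff_eq chr_mult integral_chr)

lemma H2_cmult: "f \<in> H2 \<Longrightarrow> (\<lambda>z. c * f z) \<in> H2"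
  by (auto simp: H2_def L2_cmult fcoeff_eq mult.assoc)

lemma H2_sum:
  assumes "\<And>i. i \<in> I \<Longrightarrow> f i \<in> H2"
  shows "(\<lambda>z. \<Sum>i\<in>I. f i z) \<in> H2"
proof -
  have L2: "f i \<in> L2" if "i \<in> I" for i using assms that by (simp add: H2_def)
  have "fcoeff (\<lambda>z. \<Sum>i\<in>I. f i z) m n = (\<Sum>i\<in>I. fcoeff (f i) m n)" for m n
    using L2_integrable[OF L2_mult_chr[OF L2]] by (simp add: fcoeff_eq sum_distrib_right)
  then show ?thesis using assms L2_sum[OF L2] by (auto simp: H2_def)
qed

definition trig_poly :: "nat \<Rightarrow> (nat \<Rightarrow> nat \<Rightarrow> complex) \<Rightarrow> real \<times> real \<Rightarrow> complex" where
  "trig_poly N c z = (\<Sum>j\<le>N. \<Sum>k\<le>N. c j k * chr (int j) (int k) z)"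

text \<open>Multiplying the term l of \<open>logsym\<close> by the monomial (j, k) gives the
  frequency (j + l, k - l). The first entry is never negative, so membership in the quadrant is
  decided by l <= k: the tail l > k goes here, the rest into \<open>analytic_part\<close>.\<close>

definition hankel_part :: "nat \<Rightarrow> (nat \<Rightarrow> nat \<Rightarrow> complex) \<Rightarrow> real \<times> real \<Rightarrow> complex" where
  "hankel_part N c z = (\<Sum>j\<le>N. \<Sum>k\<le>N. c j k * (logsym_tail k z * chr (int j) (int k) z))"

definition analytic_part :: "nat \<Rightarrow> (nat \<Rightarrow> nat \<Rightarrow> complex) \<Rightarrow> real \<times> real \<Rightarrow> complex" where
  "analytic_part N c z =
     (\<Sum>j\<le>N. \<Sum>k\<le>N. \<Sum>l=1..k. (c j k / of_nat l) * chr (int j + int l) (int k - int l) z)"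

lemma ATP_iff: "f \<in> ATP \<longleftrightarrow> (\<exists>N c. f = trig_poly N c)"
  by (auto simp: ATP_def trig_poly_def chr_def fun_eq_iff)

lemma L2_trig_poly: "trig_poly N c \<in> L2"
  unfolding trig_poly_def by (intro L2_sum L2_cmult L2_chr)

lemma L2_hankel_part: "hankel_part N c \<in> L2"
  unfolding hankel_part_def by (intro L2_sum L2_cmult L2_mult_chr L2_logsym_tail)

lemma H2_analytic_part: "analytic_part N c \<in> H2"
  unfolding analytic_part_def by (intro H2_sum H2_cmult H2_chr) auto

lemma logsym_mult_trig_poly:
  "logsym z * trig_poly N c z = hankel_part N c z + analytic_part N c z"
proof -
  have "c j k * (logsym_tail k z * chr (int j) (int k) z) +
      (\<Sum>l=1..k. (c j k / of_nat l) * chr (int j + int l) (int k - int l) z) =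
      logsym z * (c j k * chr (int j) (int k) z)" for j k
  proof -
    have "chr (int j + int l) (int k - int l) z = chr (int l) (- int l) z * chr (int j) (int k) z" for l
      by (simp add: chr_mult add.commute)
    then have "(\<Sum>l=1..k. (c j k / of_nat l) * chr (int j + int l) (int k - int l) z) =
        c j k * (\<Sum>l=1..k. chr (int l) (- int l) z / of_nat l) * chr (int j) (int k) z"
      by (simp add: sum_distrib_left sum_distrib_right mult_ac)
    then show ?thesis by (simp add: logsym_tail_def algebra_simps)
  qed
  then show ?thesis
    unfolding trig_poly_def hankel_part_def analytic_part_def
    by (simp add: sum_distrib_left flip: sum.distrib)
qed

text \<open>All frequencies of \<open>hankel_part\<close> have negative second entry k - l, and h
  annihilates such characters. This is applied to conjugates of H^2 functions and to
  \<open>logsym\<close> times the conjugate polynomial.\<close>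

lemma integral_hankel_part_mult:
  assumes h: "h \<in> L2"
    and zero: "\<And>a b. b < 0 \<Longrightarrow> (LINT z|T2. chr a b z * h z) = 0"
  shows "(LINT z|T2. hankel_part N c z * h z) = 0"
proof -
  have hc: "(\<lambda>z. chr a b z * h z) \<in> L2" for a b
    using L2_mult_chr[OF h] by (simp add: mult.commute)
  have i: "integrable T2 (\<lambda>z. logsym_tail k z * (chr a b z * h z))" for k a b
    by (rule L2_mult_integrable[OF L2_logsym_tail hc])
  have 0: "(LINT z|T2. logsym_tail k z * (chr (int j) (int k) z * h z)) = 0" for j k
  proof (rule integral_logsym_tail_mult[OF hc])
    fix l assume "k < l"
    then show "(LINT z|T2. chr (int l) (- int l) z * (chr (int j) (int k) z * h z)) = 0"
      using zero[of "- int l + int k" "int l + int j"] by (simp add: chr_mult flip: mult.assoc)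
  qed
  have "hankel_part N c z * h z =
      (\<Sum>j\<le>N. \<Sum>k\<le>N. c j k * (logsym_tail k z * (chr (int j) (int k) z * h z)))" for z
    by (simp add: hankel_part_def sum_distrib_right mult.assoc)
  then show ?thesis using i 0 by simp
qed

lemma hankel_part_in_H2perp: "hankel_part N c \<in> H2perp"
proof -
  have "(LINT z|T2. hankel_part N c z * cnj (h z)) = 0" if h: "h \<in> H2" for h
  proof (rule integral_hankel_part_mult)
    show "(\<lambda>z. cnj (h z)) \<in> L2" using h by (intro L2_cnj H2_L2)
    fix a b :: int assume "b < 0"
    have "(LINT z|T2. chr a b z * cnj (h z)) = cnj (fcoeff h a b)"
      using Bochner_Integration.integral_cnj[of T2 "\<lambda>z. h z * chr (- a) (- b) z"]
      unfolding fcoeff_eq complex_cnj_mult cnj_chr minus_minus by (simp only: mult.commute)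
    then show "(LINT z|T2. chr a b z * cnj (h z)) = 0"
      using h \<open>b < 0\<close> by (simp add: H2_def)
  qed
  then show ?thesis by (simp add: H2perp_def L2_hankel_part)
qed

lemma hankel_val_hankel_part: "hankel_val logsym (trig_poly N c) (hankel_part N c)"
proof -
  have "(\<lambda>z. logsym z * trig_poly N c z - hankel_part N c z) = analytic_part N c"
    by (simp add: logsym_mult_trig_poly)
  then show ?thesis
    by (simp add: hankel_val_def hankel_part_in_H2perp H2_analytic_part)
qed

text \<open>This is orthogonality to \<open>cnj logsym\<close> times the polynomial f. That product
  has the frequencies (j - l, k + l), with positive second entry, whereas those of
  \<open>hankel_part\<close> are negative there.\<close>

lemma integral_hankel_part_logsym:
  "(LINT z|T2. hankel_part N c z * (logsym z * cnj (trig_poly N c z))) = 0"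
proof (rule integral_hankel_part_mult)
  let ?t = "\<lambda>j k z. cnj (c j k) * (logsym z * chr (- int j) (- int k) z)"
  have eq: "logsym z * cnj (trig_poly N c z) = (\<Sum>j\<le>N. \<Sum>k\<le>N. ?t j k z)" for z
    by (simp add: trig_poly_def cnj_chr sum_distrib_left mult_ac)
  show "(\<lambda>z. logsym z * cnj (trig_poly N c z)) \<in> L2"
    unfolding eq by (intro L2_sum L2_cmult L2_mult_chr L2_logsym)
  fix a b :: int assume b: "b < 0"
  have "chr a b z * (logsym z * cnj (trig_poly N c z)) =
      (\<Sum>j\<le>N. \<Sum>k\<le>N. cnj (c j k) * (logsym z * chr (a - int j) (b - int k) z))" for z
    unfolding eq sum_distrib_left
    by (intro sum.cong refl) (simp add: chr_mult[of a b, symmetric] diff_conv_add_uminus del: add_uminus_conv_diff)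
  moreover have "(LINT z|T2. logsym z * chr (a - int j) (b - int k) z) = 0" for j k
    using b by (auto simp: integral_logsym_chr)
  ultimately show "(LINT z|T2. chr a b z * (logsym z * cnj (trig_poly N c z))) = 0"
    using L2_integrable[OF L2_mult_chr[OF L2_logsym]] by simp
qed

text \<open>The function q is chosen so that g + q = (\<open>logsym\<close> -
  \<open>cnj logsym\<close>) f. Both summands of q are orthogonal to g, so Pythagoras bounds the
  norm of g by that of g + q, and this product is at most 4 |f| almost everywhere.\<close>

lemma L2norm_hankel_part: "L2norm (hankel_part N c) \<le> 4 * L2norm (trig_poly N c)"
proof -
  let ?f = "trig_poly N c" and ?g = "hankel_part N c"
  define q where "q z = analytic_part N c z - cnj (logsym z) * ?f z" for z
  have "(\<lambda>z. cnj (logsym z * cnj (?f z))) \<in> L2"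
  proof (rule L2_cnj)
    have "(\<lambda>z. logsym z * cnj (?f z)) = (\<lambda>z. \<Sum>j\<le>N. \<Sum>k\<le>N. cnj (c j k) * (logsym z * chr (- int j) (- int k) z))"
      by (simp add: trig_poly_def cnj_chr sum_distrib_left mult_ac)
    then show "(\<lambda>z. logsym z * cnj (?f z)) \<in> L2"
      by (auto intro!: L2_sum L2_cmult L2_mult_chr L2_logsym)
  qed
  then have lf: "(\<lambda>z. cnj (logsym z) * ?f z) \<in> L2" by simp
  then have q: "q \<in> L2"
    unfolding q_def by (intro L2_diff H2_L2[OF H2_analytic_part])
  have "(LINT z|T2. ?g z * cnj (q z)) =
      (LINT z|T2. ?g z * cnj (analytic_part N c z)) - (LINT z|T2. ?g z * (logsym z * cnj (?f z)))"
    unfolding q_def complex_cnj_diff right_diff_distrib complex_cnj_mult complex_cnj_cnj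
    using L2_mult_integrable[OF L2_hankel_part L2_cnj[OF lf]]
      L2_mult_integrable[OF L2_hankel_part L2_cnj[OF H2_L2[OF H2_analytic_part]]]
    by (intro Bochner_Integration.integral_diff) simp_all
  then have orth: "(LINT z|T2. ?g z * cnj (q z)) = 0"
    using hankel_part_in_H2perp H2_analytic_part
    by (simp add: integral_hankel_part_logsym H2perp_def)
  have ig: "integrable T2 (\<lambda>z. (cmod (?g z))\<^sup>2)" and iq: "integrable T2 (\<lambda>z. (cmod (q z))\<^sup>2)"
    and iff: "integrable T2 (\<lambda>z. (cmod (?f z))\<^sup>2)"
    using L2_hankel_part q L2_trig_poly by (auto simp: L2_def)
  have igq: "integrable T2 (\<lambda>z. ?g z * cnj (q z))"
    by (rule L2_mult_integrable[OF L2_hankel_part L2_cnj[OF q]])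
  have "(LINT z|T2. (cmod (?g z))\<^sup>2) \<le> (LINT z|T2. (cmod (?g z))\<^sup>2 + (cmod (q z))\<^sup>2)"
    using ig iq by (intro integral_mono) auto
  \<comment> \<open>The cross term has integral zero; adding it turns the integrand into |g + q|^2,
    which can be bounded pointwise.\<close>
  also have "\<dots> = (LINT z|T2. (cmod (?g z))\<^sup>2 + (cmod (q z))\<^sup>2 + 2 * Re (?g z * cnj (q z)))"
    using ig iq igq orth by (simp del: times_complex.sel)
  also have "\<dots> \<le> (LINT z|T2. 16 * (cmod (?f z))\<^sup>2)"
  proof (rule integral_mono_AE)
    show "integrable T2 (\<lambda>z. (cmod (?g z))\<^sup>2 + (cmod (q z))\<^sup>2 + 2 * Re (?g z * cnj (q z)))"
      using ig iq igq by (simp del: times_complex.sel)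
    show "integrable T2 (\<lambda>z. 16 * (cmod (?f z))\<^sup>2)" using iff by simp
    show "AE z in T2. (cmod (?g z))\<^sup>2 + (cmod (q z))\<^sup>2 + 2 * Re (?g z * cnj (q z)) \<le> 16 * (cmod (?f z))\<^sup>2"
      using AE_T2_chr_neq_1
    proof eventually_elim
      case (elim z)
      have "\<bar>Im (logsym z)\<bar> < 2"
        using abs_Im_Ln_one_minus[OF _ elim] by (simp add: logsym_def)
      \<comment> \<open>The difference is 2 i Im, and the imaginary part is below 2 in
        modulus.\<close>
      then have "cmod (logsym z - cnj (logsym z)) \<le> 4"
        by (simp add: complex_diff_cnj norm_mult)
      then have "cmod ((logsym z - cnj (logsym z)) * ?f z) \<le> 4 * cmod (?f z)"
        by (simp add: norm_mult mult_right_mono)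
      moreover have "(logsym z - cnj (logsym z)) * ?f z = ?g z + q z"
        by (simp add: q_def left_diff_distrib logsym_mult_trig_poly)
      ultimately have "(cmod (?g z + q z))\<^sup>2 \<le> (4 * cmod (?f z))\<^sup>2"
        by (intro power_mono) auto
      moreover have "(cmod (?g z + q z))\<^sup>2 = (cmod (?g z))\<^sup>2 + (cmod (q z))\<^sup>2 + 2 * Re (?g z * cnj (q z))"
        by (simp add: cmod_power2) (simp add: power2_eq_square algebra_simps)
      ultimately show ?case by (simp add: power_mult_distrib)
    qed
  qed
  also have "\<dots> = 4\<^sup>2 * (LINT z|T2. (cmod (?f z))\<^sup>2)" by simp
  finally show ?thesis
    unfolding L2norm_def by (metis real_sqrt_le_mono real_sqrt_mult real_sqrt_abs abs_numeral)
qed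

subsection \<open>Absence of bounded symbols\<close>

lemma H2perp_L2: "g \<in> H2perp \<Longrightarrow> g \<in> L2"
  by (simp add: H2perp_def)

text \<open>Applied to the constant 1, a symbol differs from g by an H^2 function. Outside the
  quadrant its coefficients are therefore those of g, whichever symbol is taken.\<close>

lemma fcoeff_hankel_val_eq:
  assumes "\<phi> \<in> L2" "\<psi> \<in> L2" "hankel_val \<phi> (\<lambda>z. 1) g" "hankel_val \<psi> (\<lambda>z. 1) g"
    and mn: "\<not> (0 \<le> m \<and> 0 \<le> n)"
  shows "fcoeff \<phi> m n = fcoeff \<psi> m n"
proof -
  have g: "g \<in> L2" using assms by (auto simp: hankel_val_def H2perp_L2)
  have "fcoeff u m n = fcoeff g m n" if "u \<in> L2" "hankel_val u (\<lambda>z. 1) g" for u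
  proof -
    have "fcoeff (\<lambda>z. u z - g z) m n = 0"
      using that mn by (auto simp: hankel_val_def H2_def)
    moreover have "fcoeff (\<lambda>z. u z - g z) m n = fcoeff u m n - fcoeff g m n"
      using L2_integrable[OF L2_mult_chr[OF that(1)]] L2_integrable[OF L2_mult_chr[OF g]]
      by (simp add: fcoeff_eq left_diff_distrib)
    ultimately show ?thesis by simp
  qed
  then show ?thesis using assms by metis
qed

lemma sum_harm: "(\<Sum>b<N. harm b) = real N * harm N - real N"
proof (induction N)
  case (Suc N)
  have "real (Suc N) * harm (Suc N) = real (Suc N) * harm N + 1"
    by (simp add: harm_Suc distrib_left)
  with Suc show ?case by (simp add: algebra_simps)
qed simp

text \<open>Up to normalization, \<open>\<bar>\<Sum>a<N. chr a (-a)\<bar>\<^sup>2\<close> is the Fejer kernel in \<open>x - y\<close>.\<close>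

lemma norm_double_sum_fcoeff_le:
  assumes [measurable]: "\<psi> \<in> borel_measurable T2" and B: "AE z in T2. cmod (\<psi> z) \<le> B"
  shows "cmod (\<Sum>b<N. \<Sum>a<N. fcoeff \<psi> (int b - int a) (int a - int b)) \<le> B * real N"
proof -
  define D where "D z = (\<Sum>a<N. chr (int a) (- int a) z)" for z
  have D: "D \<in> L2" unfolding D_def by (intro L2_sum L2_chr)
  have DD: "D z * cnj (D z) = (\<Sum>b<N. \<Sum>a<N. chr (int a - int b) (int b - int a) z)" for z
    unfolding D_def cnj_sum sum_product cnj_chr chr_mult
    by (subst sum.swap) (simp add: add.commute)
  have \<psi>: "\<psi> \<in> L2" by (rule L2_bounded[OF assms])
  \<comment> \<open>Only the N diagonal pairs a = b have a nonzero mean, so the nonnegative kernel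
    has mass N.\<close>
  have "(LINT z|T2. D z * cnj (D z)) = of_nat N"
  proof -
    have "(LINT z|T2. chr (int a - int b) (int b - int a) z) = (if b = a then 1 else 0)" for a b
      by (auto simp: integral_chr)
    then have "(LINT z|T2. D z * cnj (D z)) = (\<Sum>b<N. \<Sum>a<N. if b = a then 1 else 0)"
      unfolding DD using L2_integrable[OF L2_chr] by simp
    then show ?thesis by simp
  qed
  moreover have "D z * cnj (D z) = of_real ((cmod (D z))\<^sup>2)" for z
    by (rule complex_norm_square[symmetric])
  ultimately have "complex_of_real (LINT z|T2. (cmod (D z))\<^sup>2) = of_real (real N)"
    by (simp only: integral_complex_of_real of_real_of_nat_eq)
  then have D2: "(LINT z|T2. (cmod (D z))\<^sup>2) = real N"
    unfolding of_real_eq_iff .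
  have "(\<Sum>b<N. \<Sum>a<N. fcoeff \<psi> (int b - int a) (int a - int b)) = (LINT z|T2. \<psi> z * (D z * cnj (D z)))"
    unfolding DD sum_distrib_left
    using L2_integrable[OF L2_mult_chr[OF \<psi>]] by (simp add: fcoeff_eq)
  also have "cmod \<dots> \<le> (LINT z|T2. cmod (\<psi> z * (D z * cnj (D z))))"
    by (rule integral_norm_bound)
  also have "\<dots> \<le> (LINT z|T2. B * (cmod (D z))\<^sup>2)"
  proof (rule integral_mono_AE)
    show iD: "integrable T2 (\<lambda>z. B * (cmod (D z))\<^sup>2)" using D by (simp add: L2_def)
    have "(\<lambda>z. \<psi> z * D z) \<in> L2"
      using L2_mult_bounded[OF D assms] by (simp add: mult.commute)
    from L2_mult_integrable[OF this L2_cnj[OF D]]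
    show "integrable T2 (\<lambda>z. cmod (\<psi> z * (D z * cnj (D z))))"
      by (auto simp: mult.assoc)
    show "AE z in T2. cmod (\<psi> z * (D z * cnj (D z))) \<le> B * (cmod (D z))\<^sup>2"
      using B
      by eventually_elim (simp add: norm_mult power2_eq_square mult_right_mono)
  qed
  also have "\<dots> = B * real N" by (simp add: D2)
  finally show ?thesis .
qed

text \<open>The double sum of coefficients equals N (harm N - 1 + c) with c the mean of the bounded
  symbol, but is at most B N in modulus. Dividing by N would bound the harmonic numbers.\<close>

lemma not_Linf_hankel_val_logsym:
  assumes "\<psi> \<in> Linf" "hankel_val \<psi> (\<lambda>z. 1) g" "hankel_val logsym (\<lambda>z. 1) g"
  shows False
proof -
  obtain B where \<psi>m: "\<psi> \<in> borel_measurable T2" and B: "AE z in T2. cmod (\<psi> z) \<le> B"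
    using assms by (auto simp: Linf_def)
  have \<psi>: "\<psi> \<in> L2" by (rule L2_bounded[OF \<psi>m B])
  let ?c = "fcoeff \<psi> 0 0"
  \<comment> \<open>The points (k, -k) with k nonzero all lie outside the quadrant. The origin lies
    inside, so the coefficient there is undetermined and is kept as \<open>?c\<close>.\<close>
  have coeff: "fcoeff \<psi> (int b - int a) (int a - int b) =
      (if a < b then 1 / of_nat (b - a) else if a = b then ?c else 0)" for a b
  proof (cases "a = b")
    case False
    then have "fcoeff \<psi> (int b - int a) (int a - int b) = fcoeff logsym (int b - int a) (int a - int b)"
      using assms by (intro fcoeff_hankel_val_eq[OF \<psi> L2_logsym]) auto
    then show ?thesis
      using False by (auto simp: fcoeff_eq integral_logsym_chr nat_diff_distrib)
  qed simp
  have row: "(\<Sum>a<N. fcoeff \<psi> (int b - int a) (int a - int b)) = of_real (harm b) + ?c" if "b < N" for b N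
  proof -
    \<comment> \<open>Row b splits at its diagonal: a < b contributes 1/(b - a), a = b gives
      \<open>?c\<close>, and a > b gives 0.\<close>
    have N: "{..<N} = {..<b} \<union> insert b {b<..<N}" using that by auto
    have "(\<Sum>a<N. fcoeff \<psi> (int b - int a) (int a - int b)) =
        (\<Sum>a<b. fcoeff \<psi> (int b - int a) (int a - int b)) +
        (\<Sum>a\<in>insert b {b<..<N}. fcoeff \<psi> (int b - int a) (int a - int b))"
      unfolding N by (rule sum.union_disjoint) auto
    also have "(\<Sum>a\<in>insert b {b<..<N}. fcoeff \<psi> (int b - int a) (int a - int b)) = ?c"
      by (simp add: coeff)
    also have "(\<Sum>a<b. fcoeff \<psi> (int b - int a) (int a - int b)) = (\<Sum>a<b. 1 / of_nat (Suc (b - Suc a)))"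
      unfolding coeff by (intro sum.cong) (auto simp: Suc_diff_Suc)
    also have "\<dots> = (\<Sum>a<b. 1 / of_nat (Suc a))"
      by (rule sum.nat_diff_reindex)
    also have "\<dots> = of_real (harm b)"
      unfolding harm_altdef by (simp add: divide_inverse)
    finally show ?thesis .
  qed
  have "harm N \<le> B + cmod ?c + 1" if "0 < N" for N
  proof -
    have "(\<Sum>b<N. \<Sum>a<N. fcoeff \<psi> (int b - int a) (int a - int b)) = (\<Sum>b<N. of_real (harm b) + ?c)"
      by (intro sum.cong refl row) auto
    also have "\<dots> = of_real (real N * harm N - real N) + of_nat N * ?c"
      unfolding sum_harm[symmetric] by (simp add: sum.distrib)
    finally have "cmod (of_real (real N * harm N - real N) + of_nat N * ?c) \<le> B * real N"
      using norm_double_sum_fcoeff_le[OF \<psi>m B, of N] by simp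
    moreover have "cmod (of_real (real N * harm N - real N)) \<le>
        cmod (of_real (real N * harm N - real N) + of_nat N * ?c) + cmod (of_nat N * ?c)"
      by (metis add_diff_cancel_right' norm_triangle_ineq4)
    ultimately have "real N * harm N - real N \<le> B * real N + real N * cmod ?c"
      unfolding norm_of_real norm_mult by simp
    then have "real N * harm N \<le> real N * (B + cmod ?c + 1)"
      by (simp add: algebra_simps)
    then show ?thesis using that by simp
  qed
  moreover have "eventually (\<lambda>N. (harm N :: real) > B + cmod ?c + 1 \<and> 0 < N) sequentially"
    using harm_at_top eventually_gt_at_top[of "0::nat"]
    by (intro eventually_conj) (auto simp: filterlim_at_top_dense)
  then obtain N :: nat where "(harm N :: real) > B + cmod ?c + 1" "0 < N"
    by (auto dest: eventually_happens)
  ultimately show False by (meson not_less)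
qed

theorem theorem2p1:
  shows "\<exists>(\<Gamma> :: (real \<times> real \<Rightarrow> complex) \<Rightarrow> (real \<times> real \<Rightarrow> complex)) \<phi>.
           \<phi> \<in> L2 \<and>
           (\<forall>f \<in> ATP. hankel_val \<phi> f (\<Gamma> f)) \<and>
           (\<exists>C. \<forall>f \<in> ATP. L2norm (\<Gamma> f) \<le> C * L2norm f) \<and>
           \<not> (\<exists>\<psi> \<in> Linf. \<forall>f \<in> ATP. hankel_val \<psi> f (\<Gamma> f))"
proof -
  \<comment> \<open>One polynomial has several representations \<open>trig_poly N c\<close>, so
    existence is shown for each f first and \<open>\<Gamma>\<close> is then obtained by
    choice.\<close>
  have "\<forall>f\<in>ATP. \<exists>g. hankel_val logsym f g \<and> L2norm g \<le> 4 * L2norm f"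
  proof
    fix f assume "f \<in> ATP"
    then obtain N c where "f = trig_poly N c" by (auto simp: ATP_iff)
    then show "\<exists>g. hankel_val logsym f g \<and> L2norm g \<le> 4 * L2norm f"
      using hankel_val_hankel_part L2norm_hankel_part by metis
  qed
  then obtain \<Gamma> where \<Gamma>: "\<forall>f\<in>ATP. hankel_val logsym f (\<Gamma> f) \<and> L2norm (\<Gamma> f) \<le> 4 * L2norm f"
    by metis
  \<comment> \<open>The constant 1 is the single test function at which a bounded symbol is
    refuted.\<close>
  have "trig_poly 0 (\<lambda>_ _. 1) = (\<lambda>z. 1)"
    by (simp add: trig_poly_def chr_def fun_eq_iff)
  then have one: "(\<lambda>z. 1) \<in> ATP" unfolding ATP_iff by metis
  show ?thesis
  proof (intro exI conjI)
    show "logsym \<in> L2" by (rule L2_logsym)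
    show "\<forall>f\<in>ATP. hankel_val logsym f (\<Gamma> f)" using \<Gamma> by blast
    show "\<forall>f\<in>ATP. L2norm (\<Gamma> f) \<le> 4 * L2norm f" using \<Gamma> by blast
    show "\<not> (\<exists>\<psi>\<in>Linf. \<forall>f\<in>ATP. hankel_val \<psi> f (\<Gamma> f))"
      using one \<Gamma> not_Linf_hankel_val_logsym by blast
  qed
qed

end
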